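(* Let $\mathscr T=(V,E)$ be a rooted directed tree with root $\mathsf{root}$. For $u,b\in V$, consider a weight system $\lambda_u=\{\lambda_{uv}\}$ of complex numbers and let $W_{f,g}$ be the rank one extension of the weighted join operator $W^{(b)}_{\lambda_u}$ on $\mathscr T$, where $f\in\ell^2(V)\ominus\mathscr H$ is non-zero and $g:U\to\mathbb C\setminus\{0\}$ is given ($U$, $\mathscr H=\ell^2(U)$, $\Gamma_{\lambda_u}$, $(\Gamma,g)^*$, $W_{f,g}$ and the compatibility conditions I and II are defined in the context). Then the following statements are true: (i) If $\{\lambda_{uv}:v\in U\}$ is closed, then $W_{f,g}$ satisfies the compatibility condition I if and only if $\Gamma_{\lambda_u}=\mathbb C\setminus\{\lambda_{uv}:v\in U\}=(\Gamma,g)^*$. (ii) If $\{\lambda_{uv}:v\in U\}$ has accumulation point only at $\infty$ with each of its entries appearing finitely many times, then $W_{f,g}$ satisfies compatibility condition II if and only if $\Gamma_{\lambda_u}=(\Gamma,g)^*$.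
   Context: Trees. A directed tree $\mathscr T=(V,E)$ is a directed graph (no loops, $V$ and $E$ nonempty) which has no circuits, is connected (ignoring orientation), and in which every non-root vertex $v$ has exactly one parent $\mathsf{par}(v)$; it is rooted if there is a unique vertex $\mathsf{root}$ without parent. Throughout $\mathrm{card}(V)=\aleph_0$. $\mathsf{Des}(u)$ is the set of descendants of $u$, including $u$; $\mathsf{Asc}(u)=\{\mathsf{par}^{\langle n\rangle}(u):n\ge1\}$; for $v\in\mathsf{Des}(u)$, $[u,v]$ is the set of vertices of the directed path from $u$ to $v$ and $\mathsf{Des}_v(u)=\mathsf{Des}(u)\setminus[u,v]$. Rank one extension. Let $u,b\in V$ and $\{\lambda_{uv}\}_{v\in V}\subseteq\mathbb C$. Put $U=V\setminus\{u\}$ if $b=u$; $U=\mathsf{Asc}(u)\cup\mathsf{Des}_b(u)$ if $b\in\mathsf{Des}(u)\setminus\{u\}$; $U=\mathsf{Des}(u)\setminus\{u\}$ if $b\notin\mathsf{Des}(u)$. Put $A_u=[u,b]$ if $b\in\mathsf{Des}(u)$ and $A_u=\mathsf{Asc}(u)\cup\{b,u\}$ otherwise. $\mathscr H=\mathscr H^{(b)}_u=\ell^2(U)\subseteq\ell^2(V)$. $D=D^{(b)}_{\lambda_u}$ is the maximally defined diagonal operator in $\mathscr H$ with $De_v=\lambda_{uv}e_v$ ($v\in U$), and $N=N^{(b)}_{\lambda_u}=e_u\otimes e_{\lambda_u,A_u}$ on $\ell^2(V)\ominus\mathscr H$, with $e_{\lambda_u,A_u}=\sum_{v\in A_u}\overline{\lambda_{uv}}e_v$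 and $(x\otimes y)h=\langle h,y\rangle x$. (The weighted join operator is $W^{(b)}_{\lambda_u}=D\oplus N$.) The operator $f\oslash g$ has domain $\{h\in\mathscr H:\sum_{v\in U}h(v)\overline{g(v)}\text{ is convergent}\}$ and $(f\oslash g)h=\big(\sum_{v\in U}h(v)\overline{g(v)}\big)f$. $W_{f,g}$ is the operator in $\ell^2(V)$ with domain $\{(h,k):h\in\mathscr D(D)\cap\mathscr D(f\oslash g),\ k\in\ell^2(V)\ominus\mathscr H\}$ and $W_{f,g}=\begin{bmatrix}D&0\\ f\oslash g&N\end{bmatrix}$. Compatibility. $\Gamma_{\lambda_u}=\{\mu\in\mathbb C:\inf_{v\in U}|\mu-\lambda_{uv}|>0\}$. For $\mu\in\mathbb C$, $g_{\lambda_u,\mu}(v)=\frac{g(v)}{\lambda_{uv}-\mu}$, $v\in U$. Compatibility condition I: there is $\mu_0\in\Gamma_{\lambda_u}$ with $g_{\lambda_u,\mu_0}\in\mathscr H$. Compatibility condition II: $\sum_{v\in U}\frac{|g(v)|^2}{|\lambda_{uv}|^2+1}<\infty$. For $g$ nowhere zero, $(\Gamma,g)^*=\{\mu\in\mathbb C:g_{\lambda_u,\mu}\in\mathscr H\}$ (in particular such $\mu$ are not among the $\lambda_{uv}$, $v\in U$). *)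

theory Defs
  imports "HOL-Analysis.Analysis" "Graph_Theory.Digraph_Component"
begin

section \<open>Rooted directed trees\<close>

text \<open>
  In \<open>Graph_Theory\<close>, \<^const>\<open>tree\<close> means: nonempty vertex set, connected after forgetting the
  orientation, and without \<^emph>\<open>directed\<close> cycles, i.e. without circuits.
\<close>

locale rooted_directed_tree = pair_loopfree_digraph T for T :: "'v pair_pre_digraph" +
  assumes arcs_nonempty: "parcs T \<noteq> {}"
    and tree: "tree (with_proj T)"
    and unique_parent:
      "\<And>v. v \<in> pverts T \<Longrightarrow> \<exists>w. (w, v) \<in> parcs T \<Longrightarrow> \<exists>!w. (w, v) \<in> parcs T"
    and unique_root: "\<exists>!r. r \<in> pverts T \<and> (\<nexists>w. (w, r) \<in> parcs T)"
    and card_verts: "countable (pverts T)" "infinite (pverts T)"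

definition par :: "'v pair_pre_digraph \<Rightarrow> 'v \<Rightarrow> 'v option" where
  "par T v = (if \<exists>!w. (w, v) \<in> parcs T then Some (THE w. (w, v) \<in> parcs T) else None)"

fun par_pow :: "'v pair_pre_digraph \<Rightarrow> nat \<Rightarrow> 'v \<Rightarrow> 'v option" where
  "par_pow T 0 v = Some v"
| "par_pow T (Suc n) v = Option.bind (par_pow T n v) (par T)"

definition Asc :: "'v pair_pre_digraph \<Rightarrow> 'v \<Rightarrow> 'v set" where
  "Asc T u = {w. \<exists>n\<ge>1. par_pow T n u = Some w}"

definition Des :: "'v pair_pre_digraph \<Rightarrow> 'v \<Rightarrow> 'v set" where
  "Des T u = {v. reachable (with_proj T) u v}"

text \<open>The vertex set $[u,v]$ of the directed path from \<open>u\<close> to \<open>v\<close>, meaningful for \<open>v \<in> Des T u\<close>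
  only (the path is then unique).\<close>

definition segment :: "'v pair_pre_digraph \<Rightarrow> 'v \<Rightarrow> 'v \<Rightarrow> 'v set" where
  "segment T u v = set (pawalk_verts u (THE p. pre_digraph.apath (with_proj T) u p v))"

definition ext_U :: "'v pair_pre_digraph \<Rightarrow> 'v \<Rightarrow> 'v \<Rightarrow> 'v set" where
  "ext_U T u b =
     (if b = u then pverts T - {u}
      else if b \<in> Des T u then Asc T u \<union> (Des T u - segment T u b)
      else Des T u - {u})"

definition ext_A :: "'v pair_pre_digraph \<Rightarrow> 'v \<Rightarrow> 'v \<Rightarrow> 'v set" where
  "ext_A T u b = (if b \<in> Des T u then segment T u b else Asc T u \<union> {b, u})"


section \<open>The operator\<close>

text \<open>
  $\ell^2(A)$ is realised as a set of functions on the whole vertex type which vanish outside \<open>A\<close>,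
  so that $\ell^2(U) \subseteq \ell^2(V)$ literally. Sums over vertex sets, which carry no
  order, are unordered sums. The inner product is linear in its first argument.
\<close>

definition ell2 :: "'v set \<Rightarrow> ('v \<Rightarrow> complex) set" where
  "ell2 A = {h. (\<lambda>v. (cmod (h v))\<^sup>2) summable_on A \<and> (\<forall>v. v \<notin> A \<longrightarrow> h v = 0)}"

definition ell2_inner :: "('v \<Rightarrow> complex) \<Rightarrow> ('v \<Rightarrow> complex) \<Rightarrow> complex" where
  "ell2_inner h k = (\<Sum>\<^sub>\<infinity>v. h v * cnj (k v))"

definition ell2_minus :: "'v set \<Rightarrow> 'v set \<Rightarrow> ('v \<Rightarrow> complex) set" where
  "ell2_minus V U = {k \<in> ell2 V. \<forall>h\<in>ell2 U. ell2_inner k h = 0}"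

definition rank_one ::
  "('v \<Rightarrow> complex) \<Rightarrow> ('v \<Rightarrow> complex) \<Rightarrow> ('v \<Rightarrow> complex) \<Rightarrow> 'v \<Rightarrow> complex" where
  "rank_one x y h = (\<lambda>v. ell2_inner h y * x v)"

definition diag_dom :: "'v set \<Rightarrow> ('v \<Rightarrow> complex) \<Rightarrow> ('v \<Rightarrow> complex) set" where
  "diag_dom U lam = {h \<in> ell2 U. (\<lambda>v. lam v * h v) \<in> ell2 U}"

definition diag_op :: "('v \<Rightarrow> complex) \<Rightarrow> ('v \<Rightarrow> complex) \<Rightarrow> 'v \<Rightarrow> complex" where
  "diag_op lam h = (\<lambda>v. lam v * h v)"

definition N_op ::
  "'v \<Rightarrow> 'v set \<Rightarrow> ('v \<Rightarrow> complex) \<Rightarrow> ('v \<Rightarrow> complex) \<Rightarrow> 'v \<Rightarrow> complex" where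
  "N_op u A lam =
     rank_one (\<lambda>v. if v = u then 1 else 0) (\<lambda>v. if v \<in> A then cnj (lam v) else 0)"

definition oslash_dom :: "'v set \<Rightarrow> ('v \<Rightarrow> complex) \<Rightarrow> ('v \<Rightarrow> complex) set" where
  "oslash_dom U g = {h \<in> ell2 U. (\<lambda>v. h v * cnj (g v)) summable_on U}"

definition oslash ::
  "'v set \<Rightarrow> ('v \<Rightarrow> complex) \<Rightarrow> ('v \<Rightarrow> complex) \<Rightarrow> ('v \<Rightarrow> complex) \<Rightarrow> 'v \<Rightarrow> complex" where
  "oslash U f g h = (\<lambda>w. (\<Sum>\<^sub>\<infinity>v\<in>U. h v * cnj (g v)) * f w)"

text \<open>$W_{f,g}$, given by its graph in $\ell^2(V) \times \ell^2(V)$; the pair $(h,k)$ of the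
  orthogonal decomposition is identified with $h + k$.\<close>

definition W_op ::
  "'v pair_pre_digraph \<Rightarrow> 'v \<Rightarrow> 'v \<Rightarrow> ('v \<Rightarrow> complex) \<Rightarrow> ('v \<Rightarrow> complex) \<Rightarrow> ('v \<Rightarrow> complex)
     \<Rightarrow> (('v \<Rightarrow> complex) \<times> ('v \<Rightarrow> complex)) set" where
  "W_op T u b lam f g =
     (let U = ext_U T u b; A = ext_A T u b in
      {(\<lambda>v. h v + k v, \<lambda>v. diag_op lam h v + (oslash U f g h v + N_op u A lam k v)) | h k.
         h \<in> diag_dom U lam \<inter> oslash_dom U g \<and> k \<in> ell2_minus (pverts T) U})"

locale rank_one_extension = rooted_directed_tree T
  for T :: "'v pair_pre_digraph" and u b :: 'v and lam f g :: "'v \<Rightarrow> complex"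
    and W :: "(('v \<Rightarrow> complex) \<times> ('v \<Rightarrow> complex)) set" +
  assumes u_vert: "u \<in> pverts T"
    and b_vert: "b \<in> pverts T"
    and f_mem: "f \<in> ell2_minus (pverts T) (ext_U T u b)"
    and f_nonzero: "f \<noteq> (\<lambda>v. 0)"
    and g_nonzero: "\<And>v. v \<in> ext_U T u b \<Longrightarrow> g v \<noteq> 0"
    and W_eq: "W = W_op T u b lam f g"


section \<open>Compatibility conditions\<close>

text \<open>
  The compatibility conditions for $W_{f,g}$ are conditions on the data \<open>lam\<close>, \<open>g\<close> on
  $U$ = \<^const>\<open>ext_U\<close> \<open>T u b\<close>, which is the argument \<open>U\<close> below.
  The infimum is taken in the extended reals, so that it is $\infty$ if \<open>U\<close> is empty.
\<close>

definition Gamma_set :: "'v set \<Rightarrow> ('v \<Rightarrow> complex) \<Rightarrow> complex set" where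
  "Gamma_set U lam = {\<mu>. (INF v\<in>U. ereal (cmod (\<mu> - lam v))) > 0}"

definition g_mu :: "'v set \<Rightarrow> ('v \<Rightarrow> complex) \<Rightarrow> ('v \<Rightarrow> complex) \<Rightarrow> complex \<Rightarrow> 'v \<Rightarrow> complex" where
  "g_mu U lam g \<mu> = (\<lambda>v. if v \<in> U then g v / (lam v - \<mu>) else 0)"

definition compat_I :: "'v set \<Rightarrow> ('v \<Rightarrow> complex) \<Rightarrow> ('v \<Rightarrow> complex) \<Rightarrow> bool" where
  "compat_I U lam g \<longleftrightarrow> (\<exists>\<mu>\<^sub>0\<in>Gamma_set U lam. g_mu U lam g \<mu>\<^sub>0 \<in> ell2 U)"

definition compat_II :: "'v set \<Rightarrow> ('v \<Rightarrow> complex) \<Rightarrow> ('v \<Rightarrow> complex) \<Rightarrow> bool" where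
  "compat_II U lam g \<longleftrightarrow> (\<lambda>v. (cmod (g v))\<^sup>2 / ((cmod (lam v))\<^sup>2 + 1)) summable_on U"

text \<open>$(\Gamma,g)^*$. The conjunct \<open>\<mu> \<notin> lam ` U\<close> says that $g_{\lambda_u,\mu}$ is defined; it is
  needed because of \<open>x / 0 = 0\<close>.\<close>

definition Gamma_star ::
  "'v set \<Rightarrow> ('v \<Rightarrow> complex) \<Rightarrow> ('v \<Rightarrow> complex) \<Rightarrow> complex set" where
  "Gamma_star U lam g = {\<mu>. \<mu> \<notin> lam ` U \<and> g_mu U lam g \<mu> \<in> ell2 U}"

end

theory Submission
  imports Defs
begin

text \<open>
  Fix \<open>\<mu>\<close> at a positive distance from the weights. Then \<open>\<bar>\<lambda> - \<mu>\<bar>\<^sup>2\<close> and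
  \<open>\<bar>\<lambda>\<bar>\<^sup>2 + 1\<close> are comparable, up to constant factors, uniformly over all weights \<open>\<lambda>\<close>, so
  square summability of \<open>g / (\<lambda> - \<mu>)\<close> is the same condition for every such \<open>\<mu>\<close>, namely
  compatibility condition II (\<open>Gamma_star_iff_compat_II\<close>). In other words,
  \<^const>\<open>Gamma_star\<close> contains either all of \<^const>\<open>Gamma_set\<close> or none of it.

  The set \<^const>\<open>Gamma_set\<close> is the complement of the closure of the weights
  (\<open>Gamma_set_eq_compl_closure\<close>). If the set of weights is closed, this is the complement of
  the weights itself, which always contains \<^const>\<open>Gamma_star\<close>; and it is nonempty,
  because the tree has countably many vertices and hence countably many weights. So condition I,
  condition II and the equality of \<^const>\<open>Gamma_set\<close> and \<^const>\<open>Gamma_star\<close> are all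
  equivalent. Both parts of the theorem are instances of this, since a set without finite
  accumulation points is closed.
\<close>

lemma Gamma_set_eq_compl_closure: "Gamma_set U lam = - closure (lam ` U)"
proof (intro equalityI subsetI)
  fix \<mu> assume "\<mu> \<in> Gamma_set U lam"
  then have "0 < (INF v\<in>U. ereal (cmod (\<mu> - lam v)))"
    by (simp add: Gamma_set_def)
  then obtain d where d: "0 < ereal d" "ereal d < (INF v\<in>U. ereal (cmod (\<mu> - lam v)))"
    using ereal_dense2 by blast
  have "d \<le> dist (lam v) \<mu>" if "v \<in> U" for v
    using less_INF_D[OF d(2) that] by (simp add: dist_norm norm_minus_commute)
  with d(1) show "\<mu> \<in> - closure (lam ` U)"
    by (force simp: closure_approachable)
next
  fix \<mu> assume "\<mu> \<in> - closure (lam ` U)"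
  then obtain d where "d > 0" "\<forall>v\<in>U. d \<le> dist (lam v) \<mu>"
    by (auto simp: closure_approachable not_less)
  then have "ereal d \<le> (INF v\<in>U. ereal (cmod (\<mu> - lam v)))"
    by (intro INF_greatest) (simp add: dist_norm norm_minus_commute)
  with \<open>d > 0\<close> show "\<mu> \<in> Gamma_set U lam"
    by (auto simp: Gamma_set_def intro: less_le_trans[of 0 "ereal d"])
qed

lemma g_mu_in_ell2_iff:
  "g_mu U lam g \<mu> \<in> ell2 U \<longleftrightarrow> (\<lambda>v. (cmod (g v))\<^sup>2 / (cmod (lam v - \<mu>))\<^sup>2) summable_on U"
proof -
  have "(\<lambda>v. (cmod (g_mu U lam g \<mu> v))\<^sup>2) summable_on U \<longleftrightarrow>
      (\<lambda>v. (cmod (g v))\<^sup>2 / (cmod (lam v - \<mu>))\<^sup>2) summable_on U"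
    by (rule summable_on_cong) (simp add: g_mu_def norm_divide power_divide)
  then show ?thesis
    by (simp add: ell2_def g_mu_def)
qed

lemma summable_on_divide_comparison:
  fixes a p q :: "'a \<Rightarrow> real"
  assumes summable: "(\<lambda>x. a x / p x) summable_on A"
    and a: "\<And>x. x \<in> A \<Longrightarrow> 0 \<le> a x"
    and p: "\<And>x. x \<in> A \<Longrightarrow> 0 < p x"
    and q: "\<And>x. x \<in> A \<Longrightarrow> 0 < q x"
    and le: "\<And>x. x \<in> A \<Longrightarrow> p x \<le> C * q x"
  shows "(\<lambda>x. a x / q x) summable_on A"
proof (rule summable_on_comparison_test)
  show "(\<lambda>x. C * (a x / p x)) summable_on A"
    by (rule summable_on_cmult_right[OF summable])
next
  fix x assume x: "x \<in> A"
  have "a x * p x \<le> a x * (C * q x)"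
    using a[OF x] le[OF x] by (rule mult_left_mono[rotated])
  with p[OF x] q[OF x] show "a x / q x \<le> C * (a x / p x)"
    by (simp add: field_simps)
  show "0 \<le> a x / q x"
    using a[OF x] q[OF x] by simp
qed

lemma norm_add_square_le: "(norm (x + y))\<^sup>2 \<le> 2 * (norm x)\<^sup>2 + 2 * (norm y)\<^sup>2"
proof -
  have "(norm (x + y))\<^sup>2 \<le> (norm x + norm y)\<^sup>2"
    by (intro power_mono norm_triangle_ineq norm_ge_zero)
  also have "\<dots> \<le> 2 * (norm x)\<^sup>2 + 2 * (norm y)\<^sup>2"
    using zero_le_power2[of "norm x - norm y"] by (simp add: power2_eq_square algebra_simps)
  finally show ?thesis .
qed

text \<open>
  The quotient of \<open>\<bar>\<lambda>\<bar>\<^sup>2 + 1\<close> and \<open>\<bar>\<lambda> - \<mu>\<bar>\<^sup>2\<close> tends to \<open>1\<close> as \<open>\<lambda>\<close> tends to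
  infinity, and stays bounded away from \<open>0\<close> and infinity as long as \<open>\<lambda>\<close> keeps away from \<open>\<mu>\<close>.
  So the choice of \<open>\<mu>\<close> does not affect summability.
\<close>

lemma Gamma_star_iff_compat_II:
  assumes "\<mu> \<in> Gamma_set U lam"
  shows "\<mu> \<in> Gamma_star U lam g \<longleftrightarrow> compat_II U lam g"
proof -
  have "\<mu> \<notin> closure (lam ` U)"
    using assms by (simp add: Gamma_set_eq_compl_closure)
  then obtain d where d: "d > 0" "\<And>v. v \<in> U \<Longrightarrow> d \<le> cmod (lam v - \<mu>)"
    by (auto simp: closure_approachable not_less dist_norm)
  have outside: "\<mu> \<notin> lam ` U"
    using \<open>\<mu> \<notin> closure (lam ` U)\<close> closure_subset by blast
  have pos: "0 < (cmod (lam v - \<mu>))\<^sup>2" if "v \<in> U" for v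
    using d(1) d(2)[OF that] by (intro zero_less_power) linarith
  have pos': "0 < (cmod (lam v))\<^sup>2 + 1" for v
    by (simp add: add_nonneg_pos)
  let ?m = "(cmod \<mu>)\<^sup>2"
  have upper: "(cmod (lam v - \<mu>))\<^sup>2 \<le> (2 * (1 + ?m)) * ((cmod (lam v))\<^sup>2 + 1)" for v
  proof -
    have "(cmod (lam v - \<mu>))\<^sup>2 \<le> 2 * (cmod (lam v))\<^sup>2 + 2 * ?m"
      using norm_add_square_le[of "lam v" "- \<mu>"] by simp
    also have "\<dots> \<le> (2 * (1 + ?m)) * ((cmod (lam v))\<^sup>2 + 1)"
      by (simp add: algebra_simps)
    finally show ?thesis .
  qed
  have lower: "(cmod (lam v))\<^sup>2 + 1 \<le> (2 + (2 * ?m + 1) / d\<^sup>2) * (cmod (lam v - \<mu>))\<^sup>2"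
    if "v \<in> U" for v
  proof -
    \<comment> \<open>The constant term is absorbed by means of \<open>\<bar>\<lambda> - \<mu>\<bar>\<^sup>2 / d\<^sup>2 \<ge> 1\<close>.\<close>
    have "d\<^sup>2 \<le> (cmod (lam v - \<mu>))\<^sup>2"
      using d(1) d(2)[OF that] by (intro power_mono) auto
    then have "(2 * ?m + 1) * 1 \<le> (2 * ?m + 1) * ((cmod (lam v - \<mu>))\<^sup>2 / d\<^sup>2)"
      using d(1) by (intro mult_left_mono) (simp_all add: field_simps)
    moreover have "(cmod (lam v))\<^sup>2 \<le> 2 * (cmod (lam v - \<mu>))\<^sup>2 + 2 * ?m"
      using norm_add_square_le[of "lam v - \<mu>" \<mu>] by simp
    ultimately show ?thesis
      by (simp add: distrib_right)
  qed
  have "g_mu U lam g \<mu> \<in> ell2 U \<longleftrightarrow> compat_II U lam g"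
    unfolding g_mu_in_ell2_iff compat_II_def
  proof
    assume "(\<lambda>v. (cmod (g v))\<^sup>2 / (cmod (lam v - \<mu>))\<^sup>2) summable_on U"
    then show "(\<lambda>v. (cmod (g v))\<^sup>2 / ((cmod (lam v))\<^sup>2 + 1)) summable_on U"
      by (rule summable_on_divide_comparison) (use pos pos' upper in auto)
  next
    assume "(\<lambda>v. (cmod (g v))\<^sup>2 / ((cmod (lam v))\<^sup>2 + 1)) summable_on U"
    then show "(\<lambda>v. (cmod (g v))\<^sup>2 / (cmod (lam v - \<mu>))\<^sup>2) summable_on U"
      by (rule summable_on_divide_comparison) (use pos pos' lower in auto)
  qed
  then show ?thesis
    using outside by (simp add: Gamma_star_def)
qed

lemma compat_I_iff_compat_II:
  assumes "Gamma_set U lam \<noteq> {}"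
  shows "compat_I U lam g \<longleftrightarrow> compat_II U lam g"
proof -
  have "g_mu U lam g \<mu> \<in> ell2 U \<longleftrightarrow> compat_II U lam g" if "\<mu> \<in> Gamma_set U lam" for \<mu>
  proof -
    have "\<mu> \<notin> lam ` U"
      using that closure_subset[of "lam ` U"] by (auto simp: Gamma_set_eq_compl_closure)
    then show ?thesis
      using Gamma_star_iff_compat_II[OF that] by (simp add: Gamma_star_def)
  qed
  then show ?thesis
    using assms by (auto simp: compat_I_def)
qed

lemma Gamma_set_eq_Gamma_star_iff_compat_II:
  assumes "closed (lam ` U)" and "Gamma_set U lam \<noteq> {}"
  shows "Gamma_set U lam = Gamma_star U lam g \<longleftrightarrow> compat_II U lam g"
proof -
  have "Gamma_star U lam g \<subseteq> Gamma_set U lam"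
    using assms(1) by (auto simp: Gamma_star_def Gamma_set_eq_compl_closure)
  then show ?thesis
    using assms(2) Gamma_star_iff_compat_II by blast
qed

lemma Gamma_set_nonempty:
  assumes "countable U" and "closed (lam ` U)"
  shows "Gamma_set U lam \<noteq> {}"
proof -
  have "lam ` U \<noteq> UNIV"
    using assms(1) uncountable_UNIV_complex countable_image by metis
  then show ?thesis
    using assms(2) by (auto simp: Gamma_set_eq_compl_closure)
qed

lemma countable_Asc: "countable (Asc T u)"
proof (rule countable_subset)
  show "Asc T u \<subseteq> range (\<lambda>n. the (par_pow T n u))"
  proof
    fix w assume "w \<in> Asc T u"
    then obtain n where "par_pow T n u = Some w"
      by (auto simp: Asc_def)
    then have "w = the (par_pow T n u)"
      by simp
    then show "w \<in> range (\<lambda>n. the (par_pow T n u))"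
      by blast
  qed
qed simp

lemma (in rooted_directed_tree) countable_ext_U: "countable (ext_U T u b)"
proof -
  have "Des T u \<subseteq> pverts T"
    using reachable_in_verts(2) by (auto simp: Des_def)
  then have "countable (Des T u)"
    using card_verts(1) by (rule countable_subset)
  then show ?thesis
    using card_verts(1) by (simp add: ext_U_def countable_Asc)
qed

theorem proposition4p10:
  fixes T :: "'v pair_pre_digraph" and u b :: 'v and lam f g :: "'v \<Rightarrow> complex"
    and W :: "(('v \<Rightarrow> complex) \<times> ('v \<Rightarrow> complex)) set" and U :: "'v set"
  assumes "rank_one_extension T u b lam f g W"
    and "U = ext_U T u b"
  shows "(closed (lam ` U) \<longrightarrow>
            (compat_I U lam g \<longleftrightarrow>
               Gamma_set U lam = - (lam ` U) \<and> - (lam ` U) = Gamma_star U lam g))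
       \<and> ((\<forall>z. \<not> z islimpt (lam ` U)) \<and> (\<forall>c\<in>lam ` U. finite {v \<in> U. lam v = c}) \<longrightarrow>
            (compat_II U lam g \<longleftrightarrow> Gamma_set U lam = Gamma_star U lam g))"
proof -
  interpret rank_one_extension T u b lam f g W
    by (fact assms(1))
  have nonempty: "Gamma_set U lam \<noteq> {}" if "closed (lam ` U)"
    using Gamma_set_nonempty[OF _ that] countable_ext_U assms(2) by simp
  have "compat_I U lam g \<longleftrightarrow>
      Gamma_set U lam = - (lam ` U) \<and> - (lam ` U) = Gamma_star U lam g"
    if closed: "closed (lam ` U)"
  proof -
    have "Gamma_set U lam = - (lam ` U)"
      using closed by (simp add: Gamma_set_eq_compl_closure)
    then show ?thesis
      using compat_I_iff_compat_II[OF nonempty[OF closed]]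
        Gamma_set_eq_Gamma_star_iff_compat_II[OF closed nonempty[OF closed]]
      by metis
  qed
  moreover have "compat_II U lam g \<longleftrightarrow> Gamma_set U lam = Gamma_star U lam g"
    if "\<forall>z. \<not> z islimpt (lam ` U)"
  proof -
    have closed: "closed (lam ` U)"
      using that by (simp add: closed_limpt)
    show ?thesis
      using Gamma_set_eq_Gamma_star_iff_compat_II[OF closed nonempty[OF closed]] by simp
  qed
  ultimately show ?thesis
    by blast
qed

end
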